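(* Let $\lambda,\mu$ be partitions and let $m\ge\max(\ell(\lambda),\ell(\mu))$. Then $$\omega\,s_{\lambda/\mu}(\mathbf p\,\|\,\boldsymbol\alpha;\boldsymbol\beta)=\prod_{i=1}^m\frac{1-\alpha_{\lambda_i-i+1}\beta_{\lambda_i-i+1}}{1-\alpha_{\mu_i-i+1}\beta_{\mu_i-i+1}}\;s_{\lambda'/\mu'}(\mathbf p\,\|\,{-\iota\boldsymbol\alpha};{-\iota\boldsymbol\beta}),$$ where $\lambda',\mu'$ are the conjugate partitions.
   Context: $\boldsymbol\alpha=(\alpha_i)_{i\in\mathbb Z}$, $\boldsymbol\beta=(\beta_i)_{i\in\mathbb Z}$ are sequences in $\mathbb C$ (with $1-\alpha_i\beta_i\ne0$); $(-\iota\boldsymbol\alpha)_i=-\alpha_{1-i}$ and $(-\iota\boldsymbol\beta)_i=-\beta_{1-i}$. For $k\in\mathbb Z$, $(z;\boldsymbol\alpha)^k=\prod_{i=1}^k(1-z\alpha_i)$ if $k\ge 0$ and $\prod_{i=k+1}^{0}(1-z\alpha_i)^{-1}$ if $k<0$; $(z|\boldsymbol\beta)^k=\prod_{i=1}^k(z-\beta_i)$ if $k\ge0$ and $\prod_{i=k+1}^0(z-\beta_i)^{-1}$ if $k<0$. $\omega$ is the (continuous) algebra involution of $\mathbb C[[p_1,p_2,\dots]]$ with $\omega p_k=(-1)^{k+1}p_k$. The Clifford algebra is generated by $\psi_i,\psi_i^*$ ($i\in\mathbb Z$) with $[\psi_i,\psi_j]_+=[\psi_i^*,\psi_j^*]_+=0$,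 $[\psi_i,\psi_j^*]_+=\delta_{ij}$. The charge $0$ Fock space has basis $|\lambda\rangle=v_{\lambda_1}\wedge v_{\lambda_2-1}\wedge v_{\lambda_3-2}\wedge\cdots$ over partitions; $\psi_j$ acts by $v_j\wedge$, $\psi_j^*$ by contraction against $v_j$; $\langle\lambda|$ is the dual basis. Normal ordering: $:\!\psi_i\psi_j^*\!:\,=\psi_i\psi_j^*$ if $i>0$, $=-\psi_j^*\psi_i$ if $i\le0$. Deformed currents for $k>0$: $J_k^{(\boldsymbol\alpha;\boldsymbol\beta)}=\sum_{i,j}A_{ij}^k:\!\psi_i\psi_j^*\!:$, the coefficient of $z^{-k}$ in $:\!\psi(z|\boldsymbol\alpha;\boldsymbol\beta)\psi^*(z|\boldsymbol\alpha;\boldsymbol\beta)\!:$ (expanded for $|\beta_a|<|z|<|\alpha_b^{-1}|$, all $a,b$), where $\psi(z|\boldsymbol\alpha;\boldsymbol\beta)=\sum_i z\frac{(z|\boldsymbol\beta)^{i-1}}{(z;\boldsymbol\alpha)^i}\psi_i$, $\psi^*(w|\boldsymbol\alpha;\boldsymbol\beta)=\sum_j(1-\alpha_j\beta_j)\frac{(w;\boldsymbol\alpha)^{j-1}}{(w|\boldsymbol\beta)^j}\psi_j^*$; explicitly $A_{ii}^k=\beta_i^k$, $A_{ij}^k=0$ for $j<i$, and $A_{ij}^k=(1-\alpha_j\beta_j)\sum_{r-s=j-i-k}e_r(-\alpha_{i+1},\dots,-\alpha_{j-1})h_s(\beta_i,\dots,\beta_j)$ for $j>i$, with $e_r,h_s$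 elementary and complete homogeneous symmetric polynomials. $H_+(\mathbf p|\boldsymbol\alpha;\boldsymbol\beta)=\sum_{k\ge1}\frac{p_k}{k}J_k^{(\boldsymbol\alpha;\boldsymbol\beta)}$ with indeterminates $\mathbf p=(p_1,p_2,\dots)$, and the skew double factorial Schur function is $s_{\lambda/\mu}(\mathbf p\,\|\,\boldsymbol\alpha;\boldsymbol\beta)=\langle\mu|e^{H_+(\mathbf p|\boldsymbol\alpha;\boldsymbol\beta)}|\lambda\rangle$. *)

theory Defs
  imports Complex_Main "HOL-Library.Multiset" "HOL-Library.Groups_Big_Fun"
begin

section \<open>Power series in arbitrarily many variables\<close>

text \<open>
  A monomial in variables indexed by \<open>'v\<close> is a finite multiset over \<open>'v\<close>, so
  arbitrary functions from multisets to coefficients are the power series in these variables.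
  For \<open>'v = nat\<close> this is the ring \<open>C[[p_1, p_2, ...]]\<close>, where the index \<open>n\<close> stands for
  the variable \<open>p_{n+1}\<close> (see \<open>pvar\<close> below).
\<close>

typedef ('v, 'a) mps = "UNIV :: ('v multiset \<Rightarrow> 'a) set"
  morphisms mps_coeff Abs_mps by simp

lemma mps_coeff_Abs [simp]: "mps_coeff (Abs_mps f) = f"
  by (simp add: Abs_mps_inverse)

lemma mps_eqI: "(\<And>m. mps_coeff f m = mps_coeff g m) \<Longrightarrow> f = g"
  by (metis ext mps_coeff_inject)

lemma finite_submultisets: "finite {a. a \<subseteq># (m :: 'v multiset)}"
proof (induction m)
  case empty
  then show ?case by simp
next
  case (add x m)
  have "{a. a \<subseteq># add_mset x m} \<subseteq> {a. a \<subseteq># m} \<union> add_mset x ` {a. a \<subseteq># m}"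
  proof
    fix a assume a: "a \<in> {a. a \<subseteq># add_mset x m}"
    show "a \<in> {a. a \<subseteq># m} \<union> add_mset x ` {a. a \<subseteq># m}"
    proof (cases "x \<in># a")
      case True
      then obtain b where b: "a = add_mset x b" by (metis multi_member_split)
      with a show ?thesis by simp
    next
      case False
      with a show ?thesis
        by (metis (no_types, lifting) UnI1 add_mset_remove_trivial diff_single_trivial mem_Collect_eq
            subset_eq_diff_conv add_mset_add_single)
    qed
  qed
  with add show ?case by (meson finite_Un finite_imageI finite_subset)
qed

instantiation mps :: (type, comm_ring_1) comm_ring_1
begin

definition "0 = Abs_mps (\<lambda>_. 0)"
definition "1 = Abs_mps (\<lambda>m. if m = {#} then 1 else 0)"
definition "f + g = Abs_mps (\<lambda>m. mps_coeff f m + mps_coeff g m)"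
definition "- f = Abs_mps (\<lambda>m. - mps_coeff f m)"
definition "f - g = Abs_mps (\<lambda>m. mps_coeff f m - mps_coeff g m)"
definition "f * g = Abs_mps (\<lambda>m. \<Sum>a\<in>{a. a \<subseteq># m}. mps_coeff f a * mps_coeff g (m - a))"

lemma mps_coeff_arith [simp]:
  "mps_coeff 0 m = (0 :: 'b)"
  "mps_coeff 1 m = (if m = {#} then 1 else (0 :: 'b))"
  "mps_coeff (f + g) m = mps_coeff f m + (mps_coeff g m :: 'b)"
  "mps_coeff (- f) m = - (mps_coeff f m :: 'b)"
  "mps_coeff (f - g) m = mps_coeff f m - (mps_coeff g m :: 'b)"
  by (simp_all add: zero_mps_def one_mps_def plus_mps_def uminus_mps_def minus_mps_def)

lemma mps_coeff_times:
  "mps_coeff (f * g) m = (\<Sum>a\<in>{a. a \<subseteq># m}. mps_coeff f a * (mps_coeff g (m - a) :: 'b))"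
  by (simp add: times_mps_def)

instance
proof
  fix f g h :: "('a, 'b) mps"
  show "f * g = g * f"
  proof (rule mps_eqI)
    fix m
    show "mps_coeff (f * g) m = mps_coeff (g * f) m"
      unfolding mps_coeff_times
      by (rule sum.reindex_bij_witness[where i = "\<lambda>a. m - a" and j = "\<lambda>a. m - a"])
        (auto simp: double_diff subset_mset.diff_diff_right mult.commute multiset_diff_union_assoc)
  qed
  show "f * g * h = f * (g * h)"
  proof (rule mps_eqI)
    fix m
    have "mps_coeff (f * g * h) m =
      (\<Sum>(a, b)\<in>(SIGMA a:{a. a \<subseteq># m}. {b. b \<subseteq># a}).
         mps_coeff f b * mps_coeff g (a - b) * mps_coeff h (m - a))"
      by (simp add: mps_coeff_times sum_distrib_right sum.Sigma finite_submultisets)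
    also have "\<dots> = (\<Sum>(b, c)\<in>(SIGMA b:{b. b \<subseteq># m}. {c. c \<subseteq># m - b}).
         mps_coeff f b * (mps_coeff g c * mps_coeff h (m - b - c)))"
    proof (rule sum.reindex_bij_witness[where i = "\<lambda>(b, c). (b + c, b)" and j = "\<lambda>(a, b). (b, a - b)"], goal_cases)
      case (1 x)
      then show ?case by auto
    next
      case (2 x)
      obtain a b where x: "x = (a, b)" by (cases x)
      with 2 have le: "count b c \<le> count a c" "count a c \<le> count m c" for c
        by (auto simp: subseteq_mset_def)
      show ?case
        using le by (auto simp: x subseteq_mset_def intro: order.trans[OF le] diff_le_mono)
    next
      case (3 x)
      then show ?case by auto
    next
      case (4 x)
      obtain b c where x: "x = (b, c)" by (cases x)
      with 4 have le: "count b d \<le> count m d" "count c d \<le> count m d - count b d" for d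
        by (auto simp: subseteq_mset_def)
      have "count b d + count c d \<le> count m d" for d
        using le_diff_conv2[OF le(1), of "count c d" d] le(2)[of d] by (simp add: add.commute)
      then show ?case
        by (auto simp: x subseteq_mset_def)
    next
      case (5 x)
      obtain a b where x: "x = (a, b)" by (cases x)
      with 5 have "m - b - (a - b) = m - a"
        by (simp add: x)
      then show ?case by (simp add: x mult.assoc)
    qed
    also have "\<dots> = mps_coeff (f * (g * h)) m"
      by (simp add: mps_coeff_times sum_distrib_left sum.Sigma finite_submultisets)
    finally show "mps_coeff (f * g * h) m = mps_coeff (f * (g * h)) m" .
  qed
  show "1 * f = f"
  proof (rule mps_eqI)
    fix m
    have "mps_coeff (1 * f) m = (\<Sum>a\<in>{a. a \<subseteq># m}. if a = {#} then mps_coeff f m else 0)"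
      unfolding mps_coeff_times by (intro sum.cong) auto
    also have "\<dots> = mps_coeff f m"
      by (simp add: finite_submultisets)
    finally show "mps_coeff (1 * f) m = mps_coeff f m" .
  qed
  show "(f + g) * h = f * h + g * h"
    by (rule mps_eqI) (simp add: mps_coeff_times algebra_simps sum.distrib)
  show "(0 :: ('a, 'b) mps) \<noteq> 1"
    by (metis mps_coeff_arith(1,2) zero_neq_one)
qed (auto intro!: mps_eqI simp: algebra_simps)

end

definition mps_const :: "'a::comm_ring_1 \<Rightarrow> ('v, 'a) mps"
  where "mps_const c = Abs_mps (\<lambda>m. if m = {#} then c else 0)"

definition mps_var :: "'v \<Rightarrow> ('v, 'a::comm_ring_1) mps"
  where "mps_var v = Abs_mps (\<lambda>m. if m = {#v#} then 1 else 0)"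

text \<open>
  Sum of a family of power series of which only finitely many members involve any given
  monomial, i.e.\ the sum in the coefficientwise topology.
\<close>

definition mps_sum :: "(nat \<Rightarrow> ('v, 'a::comm_ring_1) mps) \<Rightarrow> ('v, 'a) mps"
  where "mps_sum f = Abs_mps (\<lambda>m. Sum_any (\<lambda>n. mps_coeff (f n) m))"

lemma mps_coeff_const [simp]: "mps_coeff (mps_const c) m = (if m = {#} then c else 0)"
  by (simp add: mps_const_def)

lemma mps_coeff_var [simp]: "mps_coeff (mps_var v) m = (if m = {#v#} then 1 else 0)"
  by (simp add: mps_var_def)

lemma mps_coeff_const_times [simp]: "mps_coeff (mps_const c * f) m = c * mps_coeff f m"
proof -
  have "mps_coeff (mps_const c * f) m = (\<Sum>a\<in>{a. a \<subseteq># m}. if a = {#} then c * mps_coeff f m else 0)"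
    unfolding mps_coeff_times by (intro sum.cong) auto
  then show ?thesis by (simp add: finite_submultisets)
qed

lemma mps_coeff_var_times:
  "mps_coeff (mps_var v * f) m = (if v \<in># m then mps_coeff f (m - {#v#}) else 0)"
proof -
  have "mps_coeff (mps_var v * f) m =
      (\<Sum>a\<in>{a. a \<subseteq># m}. if a = {#v#} then mps_coeff f (m - {#v#}) else 0)"
    unfolding mps_coeff_times by (intro sum.cong) auto
  then show ?thesis by (simp add: finite_submultisets)
qed


section \<open>The ring of power series in the power sums and its involution\<close>

type_synonym series = "(nat, complex) mps"

definition pvar :: "nat \<Rightarrow> series"
  where "pvar k = mps_var (k - 1)"  \<comment> \<open>only used for \<open>k \<ge> 1\<close>\<close>

text \<open>
  The substitution \<open>p_k \<mapsto> (-1)^(k+1) p_k\<close>. The lemmas below show that this is the unique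
  algebra endomorphism with these values that is continuous for the coefficientwise topology,
  and that it is an involution.
\<close>

definition omega :: "series \<Rightarrow> series"
  where "omega f = Abs_mps (\<lambda>m. (\<Prod>n\<in>#m. (- 1) ^ (Suc n + 1)) * mps_coeff f m)"

lemma mps_coeff_omega:
  "mps_coeff (omega f) m = (\<Prod>n\<in>#m. (- 1) ^ (Suc n + 1)) * mps_coeff f m"
  by (simp add: omega_def)

lemma omega_add: "omega (f + g) = omega f + omega g"
  by (rule mps_eqI) (simp add: mps_coeff_omega algebra_simps)

lemma omega_mult: "omega (f * g) = omega f * omega g"
proof (rule mps_eqI)
  fix m
  have "(\<Prod>n\<in>#m. (- 1 :: complex) ^ (Suc n + 1)) =
      (\<Prod>n\<in>#a. (- 1) ^ (Suc n + 1)) * (\<Prod>n\<in>#m - a. (- 1) ^ (Suc n + 1))" if "a \<subseteq># m" for a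
    using that by (metis image_mset_union prod_mset.union subset_mset.add_diff_inverse)
  then show "mps_coeff (omega (f * g)) m = mps_coeff (omega f * omega g) m"
    unfolding mps_coeff_omega mps_coeff_times sum_distrib_left
    by (intro sum.cong) auto
qed

lemma omega_const: "omega (mps_const c) = mps_const c"
  by (rule mps_eqI) (simp add: mps_coeff_omega)

lemma omega_pvar: "k \<ge> 1 \<Longrightarrow> omega (pvar k) = mps_const ((- 1) ^ (k + 1)) * pvar k"
  by (cases k) (simp_all add: mps_eqI mps_coeff_omega pvar_def)

lemma omega_involution: "omega (omega f) = f"
proof (rule mps_eqI)
  fix m
  have "(\<Prod>n\<in>#m. (- 1 :: complex) ^ (Suc n + 1)) * (\<Prod>n\<in>#m. (- 1) ^ (Suc n + 1)) = 1"
    unfolding prod_mset.distrib[symmetric] power_mult_distrib[symmetric] by simp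
  then show "mps_coeff (omega (omega f)) m = mps_coeff f m"
    unfolding mps_coeff_omega mult.assoc[symmetric] by (simp only: mult_1)
qed

lemma omega_continuous: "\<exists>S. finite S \<and> (\<forall>f. (\<forall>a\<in>S. mps_coeff f a = 0) \<longrightarrow> mps_coeff (omega f) m = 0)"
  by (intro exI[of _ "{m}"]) (simp add: mps_coeff_omega)

lemma omega_unique:
  fixes W :: "series \<Rightarrow> series"
  assumes add: "\<And>f g. W (f + g) = W f + W g"
    and mult: "\<And>f g. W (f * g) = W f * W g"
    and const: "\<And>c. W (mps_const c) = mps_const c"
    and pvar: "\<And>k. k \<ge> 1 \<Longrightarrow> W (pvar k) = mps_const ((- 1) ^ (k + 1)) * pvar k"
    and cont: "\<And>m. \<exists>S. finite S \<and> (\<forall>f. (\<forall>a\<in>S. mps_coeff f a = 0) \<longrightarrow> mps_coeff (W f) m = 0)"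
  shows "W = omega"
proof -
  define mono :: "complex \<Rightarrow> nat multiset \<Rightarrow> series"
    where "mono c m = Abs_mps (\<lambda>a. if a = m then c else 0)" for c m
  have mono: "W (mono c m) = omega (mono c m)" for c m
  proof (induction m)
    case empty
    have "mono c {#} = mps_const c" by (simp add: mono_def mps_const_def)
    then show ?case by (simp add: const omega_const)
  next
    case (add n m)
    have "mono c (add_mset n m) = pvar (Suc n) * mono c m"
      by (rule mps_eqI) (auto simp: mono_def pvar_def mps_coeff_var_times dest: multi_member_split)
    then show ?case using add pvar[of "Suc n"] omega_pvar[of "Suc n"] by (simp add: mult omega_mult)
  qed
  have W0: "W 0 = 0" using add[of 0 0] by simp
  have om0: "omega 0 = 0" using omega_add[of 0 0] by simp
  have fin: "W (\<Sum>a\<in>S. mono (c a) a) = omega (\<Sum>a\<in>S. mono (c a) a)" if "finite S" for S c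
    using that by induction (simp_all add: W0 om0 add omega_add mono)
  show ?thesis
  proof (intro ext mps_eqI)
    fix f :: series and m
    obtain S where S: "finite S" "\<And>f. (\<forall>a\<in>S. mps_coeff f a = 0) \<Longrightarrow> mps_coeff (W f) m = 0"
      using cont by blast
    define S' where "S' = insert m S"
    define g where "g = (\<Sum>a\<in>S'. mono (mps_coeff f a) a)"
    have coeff_sum: "mps_coeff (\<Sum>a\<in>A. F a) b = (\<Sum>a\<in>A. mps_coeff (F a) b)"
      if "finite A" for A b and F :: "nat multiset \<Rightarrow> series"
      using that by induction simp_all
    have g: "mps_coeff g a = mps_coeff f a" if "a \<in> S'" for a
      using that S(1) by (simp add: g_def coeff_sum S'_def mono_def)
    have "f = g + (f - g)" by simp
    then have "mps_coeff (W f) m = mps_coeff (W g) m + mps_coeff (W (f - g)) m"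
      by (metis add mps_coeff_arith(3))
    also have "mps_coeff (W (f - g)) m = 0"
      by (rule S(2)) (simp add: g S'_def)
    also have "mps_coeff (W g) m = mps_coeff (omega g) m"
      using fin[of S'] S(1) by (simp add: g_def S'_def)
    also have "\<dots> = mps_coeff (omega f) m"
      using g[of m] by (simp add: mps_coeff_omega S'_def)
    finally show "mps_coeff (W f) m = mps_coeff (omega f) m" by simp
  qed
qed


section \<open>Partitions\<close>

text \<open>
  A partition is indexed from \<open>0\<close>: the part \<open>\<lambda>_i\<close> with \<open>i \<ge> 1\<close> is \<open>lam (i - 1)\<close>.
\<close>

definition is_partition :: "(nat \<Rightarrow> nat) \<Rightarrow> bool"
  where "is_partition lam \<longleftrightarrow> antimono lam \<and> finite {i. lam i \<noteq> 0}"

definition part_length :: "(nat \<Rightarrow> nat) \<Rightarrow> nat"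
  where "part_length lam = card {i. lam i \<noteq> 0}"

definition conjugate :: "(nat \<Rightarrow> nat) \<Rightarrow> nat \<Rightarrow> nat"
  where "conjugate lam j = card {i. lam i > j}"


section \<open>Fermionic Fock space\<close>

text \<open>
  The semi-infinite wedge \<open>v_{s_1} \<and> v_{s_2} \<and> ...\<close> with \<open>s_1 > s_2 > ...\<close> is encoded by the set
  \<open>{s_1, s_2, ...}\<close>. A vector is its coefficient function; the Fock space consists of the
  finitely supported functions on those sets that contain almost all negative and
  only finitely many positive integers.
\<close>

type_synonym 'a fock = "int set \<Rightarrow> 'a"

definition wedge :: "int set \<Rightarrow> 'a::comm_ring_1 fock"
  where "wedge S = (\<lambda>T. if T = S then 1 else 0)"

definition wedge_sign :: "int \<Rightarrow> int set \<Rightarrow> 'a::comm_ring_1"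
  where "wedge_sign j S = (- 1) ^ card {s \<in> S. s > j}"

definition psi :: "int \<Rightarrow> 'a::comm_ring_1 fock \<Rightarrow> 'a fock"
  where "psi j v = (\<lambda>T. if j \<in> T then wedge_sign j T * v (T - {j}) else 0)"

definition psi_star :: "int \<Rightarrow> 'a::comm_ring_1 fock \<Rightarrow> 'a fock"
  where "psi_star j v = (\<lambda>T. if j \<notin> T then wedge_sign j T * v (insert j T) else 0)"

lemma psi_wedge:
  "psi j (wedge S) = (if j \<in> S then (\<lambda>_. 0) else (\<lambda>T. wedge_sign j S * wedge (insert j S) T))"
proof -
  have "{s. (s = j \<or> s \<in> S) \<and> j < s} = {s \<in> S. j < s}" by auto
  then show ?thesis
    by (auto simp: psi_def wedge_def wedge_sign_def fun_eq_iff insert_absorb)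
qed

lemma psi_star_wedge:
  "psi_star j (wedge S) = (if j \<in> S then (\<lambda>T. wedge_sign j S * wedge (S - {j}) T) else (\<lambda>_. 0))"
proof -
  have "{s. s \<in> S \<and> s \<noteq> j \<and> j < s} = {s \<in> S. j < s}" by auto
  then show ?thesis
    by (auto simp: psi_star_def wedge_def wedge_sign_def fun_eq_iff insert_absorb)
qed

lemma wedge_sign_remove:
  assumes "finite {s \<in> S. s > i}" "j \<in> S"
  shows "wedge_sign i (S - {j}) = (if i < j then - wedge_sign i S else (wedge_sign i S :: 'a::comm_ring_1))"
proof (cases "i < j")
  case True
  then have "{s \<in> S. s > i} = insert j {s \<in> S - {j}. s > i}" using assms by auto
  moreover have "finite {s \<in> S - {j}. s > i}" using assms by (auto elim: rev_finite_subset)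
  ultimately have "card {s \<in> S. s > i} = Suc (card {s \<in> S - {j}. s > i})" by simp
  with True show ?thesis by (simp add: wedge_sign_def)
next
  case False
  then have "{s \<in> S - {j}. s > i} = {s \<in> S. s > i}" by auto
  with False show ?thesis by (simp add: wedge_sign_def)
qed

lemma wedge_sign_insert:
  assumes "finite {s \<in> S. s > i}" "j \<notin> S"
  shows "wedge_sign i (insert j S) = (if i < j then - wedge_sign i S else (wedge_sign i S :: 'a::comm_ring_1))"
proof -
  have "{s \<in> insert j S. s > i} \<subseteq> insert j {s \<in> S. s > i}" by auto
  then have "finite {s \<in> insert j S. s > i}" using assms(1) by (meson finite.insertI finite_subset)
  then show ?thesis
    using wedge_sign_remove[of "insert j S" i j, where 'a = 'a] assms(2)
    by (simp split: if_splits)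
qed

lemma clifford_relations:
  fixes v :: "'a::comm_ring_1 fock"
  assumes "\<And>a. finite {s \<in> T. s > a}"
  shows "psi i (psi j v) T + psi j (psi i v) T = 0"
    and "psi_star i (psi_star j v) T + psi_star j (psi_star i v) T = 0"
    and "psi i (psi_star j v) T + psi_star j (psi i v) T = (if i = j then v T else 0)"
proof -
  have sq: "wedge_sign a S * (wedge_sign a S * x) = x" for a S and x :: 'a
    by (simp add: wedge_sign_def flip: mult.assoc power_mult_distrib)
  have sets: "T - {i} - {j} = T - {j} - {i}" "insert i (insert j T) = insert j (insert i T)"
    by auto
  note sign = wedge_sign_remove[OF assms, where 'a = 'a] wedge_sign_insert[OF assms, where 'a = 'a]
  show "psi i (psi j v) T + psi j (psi i v) T = 0"
    unfolding psi_def sets(1) by (cases i j rule: linorder_cases) (simp_all add: sign)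
  show "psi_star i (psi_star j v) T + psi_star j (psi_star i v) T = 0"
    unfolding psi_star_def sets(2) by (cases i j rule: linorder_cases) (simp_all add: sign)
  show "psi i (psi_star j v) T + psi_star j (psi i v) T = (if i = j then v T else 0)"
  proof (cases "i = j")
    case True
    then show ?thesis
      by (cases "i \<in> T") (simp_all add: psi_def psi_star_def sign insert_absorb sq)
  next
    case False
    then have "insert j (T - {i}) = insert j T - {i}" by auto
    with False show ?thesis
      unfolding psi_def psi_star_def by (cases i j rule: linorder_cases) (simp_all add: sign)
  qed
qed

definition normal_ordered :: "int \<Rightarrow> int \<Rightarrow> 'a::comm_ring_1 fock \<Rightarrow> 'a fock"
  where "normal_ordered i j v =
    (if i > 0 then psi i (psi_star j v) else (\<lambda>T. - psi_star j (psi i v) T))"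

definition part_set :: "(nat \<Rightarrow> nat) \<Rightarrow> int set"
  where "part_set lam = range (\<lambda>i. int (lam i) - int i)"

definition ket :: "(nat \<Rightarrow> nat) \<Rightarrow> 'a::comm_ring_1 fock"
  where "ket lam = wedge (part_set lam)"

definition bra :: "(nat \<Rightarrow> nat) \<Rightarrow> 'a::comm_ring_1 fock \<Rightarrow> 'a"
  where "bra mu v = v (part_set mu)"


section \<open>Deformed currents and skew double factorial Schur functions\<close>

definition esym :: "nat \<Rightarrow> 'b set \<Rightarrow> ('b \<Rightarrow> 'a::comm_ring_1) \<Rightarrow> 'a"
  where "esym r I x = (\<Sum>R\<in>{R. R \<subseteq> I \<and> card R = r}. \<Prod>a\<in>R. x a)"

definition hsym :: "nat \<Rightarrow> 'b set \<Rightarrow> ('b \<Rightarrow> 'a::comm_ring_1) \<Rightarrow> 'a"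
  where "hsym s I x = (\<Sum>M\<in>{M. set_mset M \<subseteq> I \<and> size M = s}. \<Prod>a\<in>#M. x a)"

text \<open>
  The coefficient of \<open>z^(-k)\<close>, \<open>k \<ge> 1\<close>, in the product of the coefficient of \<open>\<psi>_i\<close> in
  \<open>\<psi>(z|\<alpha>;\<beta>) = \<Sum>_i z (z|\<beta>)^(i-1) / (z;\<alpha>)^i \<psi>_i\<close> and that of \<open>\<psi>*_j\<close> in
  \<open>\<psi>*(z|\<alpha>;\<beta>) = \<Sum>_j (1 - \<alpha>_j \<beta>_j) (z;\<alpha>)^(j-1) / (z|\<beta>)^j \<psi>*_j\<close>, expanded for
  \<open>|\<beta>_a| < |z| < 1/|\<alpha>_b|\<close>. For \<open>i < j\<close> this product is
  \<open>(1 - \<alpha>_j \<beta>_j) z \<Prod>_{i<a<j} (1 - \<alpha>_a z) / \<Prod>_{i\<le>a\<le>j} (z - \<beta>_a)\<close>.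
  The bound on \<open>r\<close> keeps the index set finite; \<open>e_r\<close> in the \<open>j - i - 1\<close> variables
  \<open>-\<alpha>_{i+1}, ..., -\<alpha>_{j-1}\<close> vanishes for larger \<open>r\<close>.
\<close>

definition current_coeff :: "(int \<Rightarrow> complex) \<Rightarrow> (int \<Rightarrow> complex) \<Rightarrow> nat \<Rightarrow> int \<Rightarrow> int \<Rightarrow> complex"
  where "current_coeff \<alpha> \<beta> k i j =
    (if j < i then 0
     else if j = i then \<beta> i ^ k
     else (1 - \<alpha> j * \<beta> j) *
       (\<Sum>(r, s)\<in>{(r :: nat, s :: nat). int r - int s = j - i - int k \<and> int r \<le> j - i - 1}.
          esym r {i + 1..j - 1} (\<lambda>a. - \<alpha> a) * hsym s {i..j} \<beta>))"

text \<open>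
  On a vector of the Fock space only finitely many of the terms are nonzero at any given wedge.
\<close>

definition current :: "(int \<Rightarrow> complex) \<Rightarrow> (int \<Rightarrow> complex) \<Rightarrow> nat \<Rightarrow> series fock \<Rightarrow> series fock"
  where "current \<alpha> \<beta> k v =
    (\<lambda>T. Sum_any (\<lambda>(i, j). mps_const (current_coeff \<alpha> \<beta> k i j) * normal_ordered i j v T))"

text \<open>The summand with index \<open>n\<close> is the term for \<open>k = n + 1\<close>.\<close>

definition H_plus :: "(int \<Rightarrow> complex) \<Rightarrow> (int \<Rightarrow> complex) \<Rightarrow> series fock \<Rightarrow> series fock"
  where "H_plus \<alpha> \<beta> v =
    (\<lambda>T. mps_sum (\<lambda>n. mps_const (1 / of_nat (Suc n)) * pvar (Suc n) * current \<alpha> \<beta> (Suc n) v T))"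

text \<open>
  For \<open>X = H_plus \<alpha> \<beta>\<close> and a wedge \<open>v\<close>, the coefficients of \<open>X^n v\<close> are homogeneous of
  degree \<open>n\<close> in the variables, so the exponential series is a legitimate formal sum.
\<close>

definition exp_op :: "(series fock \<Rightarrow> series fock) \<Rightarrow> series fock \<Rightarrow> series fock"
  where "exp_op X v = (\<lambda>T. mps_sum (\<lambda>n. mps_const (1 / fact n) * (X ^^ n) v T))"

definition skew_schur ::
    "(nat \<Rightarrow> nat) \<Rightarrow> (nat \<Rightarrow> nat) \<Rightarrow> (int \<Rightarrow> complex) \<Rightarrow> (int \<Rightarrow> complex) \<Rightarrow> series"
  where "skew_schur lam mu \<alpha> \<beta> = bra mu (exp_op (H_plus \<alpha> \<beta>) (ket lam))"

definition neg_iota :: "(int \<Rightarrow> complex) \<Rightarrow> int \<Rightarrow> complex"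
  where "neg_iota \<alpha> = (\<lambda>i. - \<alpha> (1 - i))"

end

theory Submission
  imports Defs
begin

text \<open>
  The proof is particle-hole duality. Exchanging occupied and empty positions and reflecting the
  line by \<open>s \<mapsto> 1 - s\<close> sends the wedge of a partition to the wedge of its conjugate. Under this
  map the process of moving a particle from \<open>j\<close> to \<open>i < j\<close> becomes the process of moving a
  particle from \<open>1 - i\<close> to \<open>1 - j\<close>, and the matrix elements of the two processes can be compared
  one by one:

  \<^item> The fermionic signs count occupied positions between \<open>i\<close> and \<open>j\<close> on one side and empty ones on
    the other, so they differ by \<open>(-1)^(j - i - 1)\<close>.

  \<^item> Up to the prefactor \<open>1 - \<alpha>_j \<beta>_j\<close>, the number \<open>A_ij^k\<close> is homogeneous of degree
    \<open>r + s \<equiv> j - i - k (mod 2)\<close> in the parameters, so negating them costs \<open>(-1)^(j - i - k)\<close>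
    (\<open>current_coeff_neg_iota\<close>).

  \<^item> The prefactor \<open>1 - \<alpha>_j \<beta>_j\<close> becomes \<open>1 - \<alpha>_i \<beta>_i\<close>. The quotient of the two is a coboundary:
    it is the ratio of the values, before and after the move, of the regularized product of the
    numbers \<open>1 - \<alpha>_s \<beta>_s\<close> over the occupied positions \<open>s\<close> (\<open>weight\<close>).

  The signs combine to \<open>(-1)^(k + 1)\<close>, which is the sign that \<open>\<omega>\<close> attaches to \<open>p_k\<close>. Normal ordering
  produces the same sign for the diagonal terms \<open>i = j\<close>. Hence duality composed with \<open>\<omega>\<close> and with
  multiplication by the weight intertwines the operators \<open>H_+\<close> for the two sets of parameters
  (\<open>dual_related_H_plus\<close>), and therefore also their exponentials. The product in the theorem is the
  ratio of the weights of \<open>\<lambda>\<close> and \<open>\<mu>\<close>.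

  Since the terms correspond bijectively, all infinite sums are transported by reindexing, and
  questions of convergence do not arise.
\<close>


section \<open>Constants, the involution, and formal sums\<close>

lemma mps_const_mult: "mps_const (a * b) = mps_const a * mps_const b"
  by (rule mps_eqI) simp

lemma mps_const_minus: "mps_const (- a) = - mps_const a"
  by (rule mps_eqI) simp

lemma mps_const_0 [simp]: "mps_const 0 = 0"
  by (rule mps_eqI) simp

lemma mps_const_1 [simp]: "mps_const 1 = 1"
  by (rule mps_eqI) simp

lemma mps_const_minus_one_power: "mps_const ((- 1) ^ n) = (- 1) ^ n"
  by (induction n) (simp_all add: mps_const_minus)

lemma omega_0 [simp]: "omega 0 = 0"
  by (rule mps_eqI) (simp add: mps_coeff_omega)

lemma omega_1 [simp]: "omega 1 = 1"
  using omega_const[of 1] by simp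

lemma omega_minus: "omega (- f) = - omega f"
  by (rule mps_eqI) (simp add: mps_coeff_omega)

lemma omega_minus_one_power: "omega ((- 1) ^ n) = (- 1) ^ n"
  using omega_const[of "(- 1) ^ n"] by (simp add: mps_const_minus_one_power)

text \<open>
  Injectivity makes the supports of both families equal, so this also covers families of
  infinite support, for which both sides vanish.
\<close>

lemma Sum_any_hom:
  fixes h :: "'a::comm_monoid_add \<Rightarrow> 'b::comm_monoid_add"
  assumes add: "\<And>x y. h (x + y) = h x + h y" and zero: "\<And>x. h x = 0 \<longleftrightarrow> x = 0"
  shows "Sum_any (\<lambda>n. h (f n)) = h (Sum_any f)"
proof -
  have "sum (\<lambda>n. h (f n)) A = h (sum f A)" for A
    by (induction A rule: infinite_finite_induct) (simp_all add: add zero)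
  then show ?thesis
    by (simp add: Sum_any.expand_set zero)
qed

definition twist :: "complex \<Rightarrow> series \<Rightarrow> series"
  where "twist c f = mps_const c * omega f"

lemma mps_coeff_twist:
  "mps_coeff (twist c f) m = c * (\<Prod>n\<in>#m. (- 1) ^ (Suc n + 1)) * mps_coeff f m"
  by (simp add: twist_def mps_coeff_omega mult.assoc)

lemma twist_add: "twist c (f + g) = twist c f + twist c g"
  by (simp add: twist_def omega_add algebra_simps)

lemma minus_one_prod_mset_neq_0: "(\<Prod>n\<in>#m. (- 1 :: complex) ^ (Suc n + 1)) \<noteq> 0"
  by (induction m) simp_all

lemma twist_eq_0_iff:
  assumes "c \<noteq> 0"
  shows "twist c f = 0 \<longleftrightarrow> f = 0"
proof
  assume "twist c f = 0"
  then have "mps_coeff (twist c f) m = 0" for m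
    by simp
  then show "f = 0"
    using assms minus_one_prod_mset_neq_0 by (intro mps_eqI) (simp add: mps_coeff_twist)
qed (simp add: twist_def)

lemma twist_mps_sum:
  assumes "c \<noteq> 0"
  shows "mps_sum (\<lambda>n. twist c (f n)) = twist c (mps_sum f)"
proof (rule mps_eqI)
  fix m
  show "mps_coeff (mps_sum (\<lambda>n. twist c (f n))) m = mps_coeff (twist c (mps_sum f)) m"
    unfolding mps_sum_def mps_coeff_Abs mps_coeff_twist
    using assms minus_one_prod_mset_neq_0
    by (intro Sum_any_hom) (simp_all add: algebra_simps)
qed


section \<open>Particle-hole duality\<close>

text \<open>The position sets of the wedges that occur in the Fock space, of any charge.\<close>

definition maya :: "int set \<Rightarrow> bool"
  where "maya T \<longleftrightarrow> finite (T \<inter> {0<..}) \<and> finite ({..0} - T)"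

definition dual_set :: "int set \<Rightarrow> int set"
  where "dual_set T = {s. 1 - s \<notin> T}"

lemma dual_set_involution [simp]: "dual_set (dual_set T) = T"
  by (simp add: dual_set_def)

lemma dual_set_move: "insert (1 - i) (dual_set T - {1 - j}) = dual_set (insert j (T - {i}))" if "i \<noteq> j"
  using that by (auto simp: dual_set_def)

lemma maya_move: "maya (insert j (T - {i}))" if "maya T"
proof -
  have "insert j (T - {i}) \<inter> {0<..} \<subseteq> insert j (T \<inter> {0<..})"
    and "{..0} - insert j (T - {i}) \<subseteq> insert i ({..0} - T)"
    by auto
  then show ?thesis
    using that unfolding maya_def by (meson finite_insert finite_subset)
qed

lemma maya_finite_greater: "finite {s \<in> T. s > a}" if "maya T"
proof (rule finite_subset)
  show "{s \<in> T. s > a} \<subseteq> (T \<inter> {0<..}) \<union> {a..0}" by auto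
qed (use that in \<open>simp add: maya_def\<close>)

lemma maya_dual_set: "maya (dual_set T)" if "maya T"
proof -
  have "dual_set T \<inter> {0<..} = (\<lambda>s. 1 - s) ` ({..0} - T)"
    and "{..0} - dual_set T = (\<lambda>s. 1 - s) ` (T \<inter> {0<..})"
    by (auto simp: dual_set_def set_eq_iff image_iff intro!: bexI[of _ "1 - _"])
  then show ?thesis
    using that by (simp add: maya_def)
qed

lemma conjugate_greater_iff:
  assumes "is_partition lam"
  shows "i < conjugate lam j \<longleftrightarrow> lam i > j"
proof -
  define A where "A = {i. lam i > j}"
  have "finite A"
    using assms by (auto simp: A_def is_partition_def elim: rev_finite_subset)
  moreover have "i' \<in> A" if "i \<in> A" "i' \<le> i" for i i'
    using assms that by (auto simp: A_def is_partition_def dest!: antimonoD[OF _ that(2)])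
  ultimately have "A = {..<card A}"
  proof -
    define n where "n = (LEAST n. n \<notin> A)"
    have "\<exists>n. n \<notin> A" using \<open>finite A\<close> by (meson ex_new_if_finite infinite_UNIV_nat)
    then have "n \<notin> A" unfolding n_def by (rule LeastI_ex)
    moreover have "i \<in> A" if "i < n" for i using not_less_Least[of i] that n_def by auto
    ultimately have "A = {..<n}"
      using \<open>\<And>i i'. i \<in> A \<Longrightarrow> i' \<le> i \<Longrightarrow> i' \<in> A\<close> by (auto simp: not_less[symmetric])
    then show ?thesis by simp
  qed
  then show ?thesis
    by (auto simp: conjugate_def A_def)
qed

text \<open>
  No sum \<open>\<lambda>_i + \<lambda>'_j\<close> equals \<open>i + j + 1\<close> (with \<open>i, j \<ge> 0\<close>), as a box is inside or outside the
  diagram; so the reflected positions of the conjugate are holes. Conversely, if \<open>i\<close> particles lie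
  above a hole at \<open>s\<close> and \<open>j = s + i - 1\<close> holes lie below it, then column \<open>j\<close> has length \<open>i\<close>.
\<close>

lemma part_set_conjugate:
  assumes lam: "is_partition lam"
  shows "part_set (conjugate lam) = dual_set (part_set lam)"
proof (intro equalityI subsetI)
  fix t assume "t \<in> part_set (conjugate lam)"
  then obtain j where t: "t = int (conjugate lam j) - int j"
    by (auto simp: part_set_def)
  have "1 - t \<noteq> int (lam i) - int i" for i
    using conjugate_greater_iff[OF lam, of i j] t by linarith
  then show "t \<in> dual_set (part_set lam)"
    by (auto simp: dual_set_def part_set_def)
next
  fix t assume t: "t \<in> dual_set (part_set lam)"
  define s where "s = 1 - t"
  have s: "int (lam i) - int i \<noteq> s" for i
  proof
    assume "int (lam i) - int i = s"
    then have "s \<in> part_set lam" unfolding part_set_def by blast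
    with t show False by (simp add: dual_set_def s_def)
  qed
  have "\<exists>i. int (lam i) - int i < s"
  proof
    have "lam (lam 0 + nat (1 - s)) \<le> lam 0"
      using lam by (auto simp: is_partition_def intro: antimonoD)
    then show "int (lam (lam 0 + nat (1 - s))) - int (lam 0 + nat (1 - s)) < s"
      by linarith
  qed
  then obtain i where i: "int (lam i) - int i < s" "\<And>i'. i' < i \<Longrightarrow> \<not> int (lam i') - int i' < s"
    using exists_least_iff[of "\<lambda>i. int (lam i) - int i < s"] by blast
  define j where "j = nat (s + int i - 1)"
  have j: "int j = s + int i - 1"
    using i(1) by (simp add: j_def)
  have "\<not> i < conjugate lam j"
    using i(1) j by (simp add: conjugate_greater_iff[OF lam])
  moreover have "i - 1 < conjugate lam j" if "i > 0"
    using i(2)[of "i - 1"] s[of "i - 1"] that j by (simp add: conjugate_greater_iff[OF lam] of_nat_diff)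
  ultimately have "conjugate lam j = i"
    by (cases "i = 0") auto
  then have "t = int (conjugate lam j) - int j"
    by (simp add: j s_def)
  then show "t \<in> part_set (conjugate lam)"
    by (auto simp: part_set_def)
qed

lemma maya_part_set: "maya (part_set lam)" if lam: "is_partition lam"
proof -
  have fin: "finite {i. lam i \<noteq> 0}"
    using lam by (simp add: is_partition_def)
  have "part_set lam \<inter> {0<..} \<subseteq> (\<lambda>i. int (lam i) - int i) ` {i. lam i \<noteq> 0}"
    by (auto simp: part_set_def)
  moreover have "{..0} - part_set lam \<subseteq> (\<lambda>i. - int i) ` {i. lam i \<noteq> 0}"
  proof
    fix s assume s: "s \<in> {..0} - part_set lam"
    then have "s = - int (nat (- s))" by simp
    moreover have "lam (nat (- s)) \<noteq> 0"
      using s by (auto simp: part_set_def image_iff dest: spec[of _ "nat (- s)"])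
    ultimately show "s \<in> (\<lambda>i. - int i) ` {i. lam i \<noteq> 0}" by blast
  qed
  ultimately show ?thesis
    using fin unfolding maya_def by (meson finite_imageI finite_subset)
qed


section \<open>The weight of a position set\<close>

text \<open>
  The product of \<open>w\<close> over the infinite set \<open>T\<close>, regularized by dividing by the product over the
  positions of the vacuum.
\<close>

definition weight :: "(int \<Rightarrow> complex) \<Rightarrow> int set \<Rightarrow> complex"
  where "weight w T = (\<Prod>s\<in>T \<inter> {0<..}. w s) / (\<Prod>s\<in>{..0} - T. w s)"

lemma weight_neq_0: "weight w T \<noteq> 0" if "\<And>s. w s \<noteq> 0"
proof -
  have "prod w A \<noteq> 0" for A
    using that by (induction A rule: infinite_finite_induct) simp_all
  then show ?thesis by (simp add: weight_def)
qed

lemma weight_remove: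
  assumes w: "\<And>s. w s \<noteq> 0" and T: "maya T" and i: "i \<in> T"
  shows "weight w T = w i * weight w (T - {i})"
proof (cases "i > 0")
  case True
  then have "(T - {i}) \<inter> {0<..} = T \<inter> {0<..} - {i}" and "{..0} - (T - {i}) = {..0} - T"
    by auto
  moreover have "i \<in> T \<inter> {0<..}" "finite (T \<inter> {0<..})"
    using True i T by (simp_all add: maya_def)
  ultimately show ?thesis
    unfolding weight_def by (simp add: prod.remove[of "T \<inter> {0<..}" i])
next
  case False
  then have "(T - {i}) \<inter> {0<..} = T \<inter> {0<..}" and "{..0} - (T - {i}) = insert i ({..0} - T)"
    by auto
  moreover have "finite ({..0} - T)"
    using T by (simp add: maya_def)
  ultimately show ?thesis
    unfolding weight_def using i w by simp
qed

lemma weight_move: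
  assumes w: "\<And>s. w s \<noteq> 0" and T: "maya T" and "i \<in> T" "j \<notin> T"
  shows "w i * weight w (insert j (T - {i})) = w j * weight w T"
proof -
  have "insert j (T - {i}) - {j} = T - {i}"
    using assms(4) by auto
  then show ?thesis
    using weight_remove[OF w maya_move[OF T], of j j i] weight_remove[OF w T assms(3)] by simp
qed

text \<open>
  From position \<open>-m\<close> downwards the wedge of a partition with at most \<open>m\<close> parts agrees with the
  vacuum, so only the first \<open>m\<close> positions contribute.
\<close>

lemma weight_part_set:
  assumes w: "\<And>s. w s \<noteq> 0" and lam: "is_partition lam" and m: "m \<ge> part_length lam"
  shows "(\<Prod>i<m. w (int (lam i) - int i)) = weight w (part_set lam) * (\<Prod>s\<in>{- int m<..0}. w s)"
proof -
  let ?S = "part_set lam" and ?f = "\<lambda>i. int (lam i) - int i"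
  have anti: "lam i' \<le> lam i" if "i \<le> i'" for i i'
    using lam that by (auto simp: is_partition_def intro: antimonoD)
  have zero: "lam i = 0" if "i \<ge> m" for i
  proof (rule ccontr)
    assume "lam i \<noteq> 0"
    moreover have "lam i \<le> lam i'" if "i' \<in> {..i}" for i'
      using anti that by simp
    ultimately have "{..i} \<subseteq> {i. lam i \<noteq> 0}"
      by fastforce
    then have "card {..i} \<le> part_length lam"
      unfolding part_length_def using lam by (intro card_mono) (simp_all add: is_partition_def)
    with m that show False by simp
  qed
  have decr: "?f i' < ?f i" if "i < i'" for i i'
    using anti[of i i'] that by simp
  then have inj: "inj ?f"
    by (intro linorder_injI) (metis less_irrefl)
  have top: "?f ` {..<m} = ?S \<inter> {- int m<..}"
  proof (intro equalityI subsetI)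
    fix s assume "s \<in> ?S \<inter> {- int m<..}"
    then obtain i where i: "s = ?f i" "s > - int m" by (auto simp: part_set_def)
    then have "i < m" using zero[of i] by (cases "i < m") auto
    with i show "s \<in> ?f ` {..<m}" by blast
  qed (auto simp: part_set_def)
  have low: "s \<in> ?S" if "s \<le> - int m" for s
  proof -
    have "s = ?f (nat (- s))" using zero[of "nat (- s)"] that by simp
    then show ?thesis unfolding part_set_def by blast
  qed
  have maya: "finite (?S \<inter> {0<..})" "finite ({..0} - ?S)"
    using maya_part_set[OF lam] by (simp_all add: maya_def)
  have "(\<Prod>i<m. w (?f i)) = (\<Prod>s\<in>?S \<inter> {- int m<..}. w s)"
    unfolding top[symmetric] by (subst prod.reindex) (use inj in \<open>auto simp: inj_on_def\<close>)
  also have "?S \<inter> {- int m<..} = (?S \<inter> {0<..}) \<union> (?S \<inter> {- int m<..0})"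
    by auto
  also have "(\<Prod>s\<in>\<dots>. w s) = (\<Prod>s\<in>?S \<inter> {0<..}. w s) * (\<Prod>s\<in>?S \<inter> {- int m<..0}. w s)"
    using maya by (intro prod.union_disjoint) auto
  finally have 1: "(\<Prod>i<m. w (?f i)) =
    (\<Prod>s\<in>?S \<inter> {0<..}. w s) * (\<Prod>s\<in>?S \<inter> {- int m<..0}. w s)" .
  have "{- int m<..0} = ({..0} - ?S) \<union> (?S \<inter> {- int m<..0})"
    using low by (auto simp: not_le[symmetric])
  then have "(\<Prod>s\<in>{- int m<..0}. w s) = (\<Prod>s\<in>({..0} - ?S) \<union> (?S \<inter> {- int m<..0}). w s)"
    by simp
  also have "\<dots> = (\<Prod>s\<in>{..0} - ?S. w s) * (\<Prod>s\<in>?S \<inter> {- int m<..0}. w s)"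
    using maya by (intro prod.union_disjoint) auto
  finally show ?thesis
    using w 1 maya by (simp add: weight_def)
qed


section \<open>Matrix elements of the currents\<close>

lemma esym_reindex:
  assumes "inj f"
  shows "esym r (f ` I) x = esym r I (\<lambda>a. x (f a))"
  unfolding esym_def
proof (rule sum.reindex_bij_witness[where i = "\<lambda>R. f ` R" and j = "\<lambda>R. f -` R"], goal_cases)
  case (1 R)
  then show ?case using assms by (auto simp: image_vimage_eq)
next
  case (2 R)
  then have "R \<subseteq> range f" and "f -` R \<subseteq> f -` f ` I" by auto
  with 2 show ?case
    using assms by (simp add: inj_vimage_image_eq card_vimage_inj)
next
  case (3 R)
  then show ?case using assms by (auto simp: inj_vimage_image_eq)
next
  case (4 R)
  then show ?case using assms by (auto simp: card_image inj_on_subset)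
next
  case (5 R)
  then have "R = f ` (f -` R)" by auto
  then have "(\<Prod>a\<in>R. x a) = (\<Prod>a\<in>f ` (f -` R). x a)" by simp
  also have "\<dots> = (\<Prod>a\<in>f -` R. x (f a))"
    using inj_on_subset[OF assms] by (subst prod.reindex) auto
  finally show ?case by simp
qed

lemma hsym_reindex:
  assumes "inj f"
  shows "hsym s (f ` I) x = hsym s I (\<lambda>a. x (f a))"
  unfolding hsym_def
proof (rule sum.reindex_bij_witness[where i = "image_mset f" and j = "image_mset (inv f)"], goal_cases)
  case (1 M)
  then have "image_mset (\<lambda>a. f (inv f a)) M = image_mset (\<lambda>a. a) M"
    by (intro image_mset_cong) (auto simp: f_inv_into_f)
  then show ?case by (simp add: multiset.map_comp comp_def)
next
  case (2 M)
  then show ?case using assms by auto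
next
  case (3 M)
  then show ?case using assms by (simp add: multiset.map_comp)
next
  case (4 M)
  then show ?case by auto
next
  case (5 M)
  then have "image_mset (\<lambda>a. x (f (inv f a))) M = image_mset x M"
    by (intro image_mset_cong) (auto simp: f_inv_into_f)
  then show ?case by (simp add: multiset.map_comp comp_def)
qed

lemma esym_minus: "esym r I (\<lambda>a. - x a) = (- 1) ^ r * esym r I x"
  unfolding esym_def sum_distrib_left by (intro sum.cong) (auto simp: prod_uminus)

lemma hsym_minus: "hsym s I (\<lambda>a. - x a) = (- 1) ^ s * hsym s I x"
proof -
  have "(\<Prod>a\<in>#M. - x a) = (- 1) ^ size M * (\<Prod>a\<in>#M. x a)" for M
    by (induction M) simp_all
  then show ?thesis
    unfolding hsym_def sum_distrib_left by (intro sum.cong) auto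
qed

text \<open>
  The parity of \<open>j - i - k = r - s\<close> is that of the total degree \<open>r + s\<close>. The sign is moved to the
  left to avoid negative exponents.
\<close>

lemma current_coeff_neg_iota:
  assumes "i < j"
  shows "(- 1) ^ k * ((1 - \<alpha> j * \<beta> j) * current_coeff (neg_iota \<alpha>) (neg_iota \<beta>) k (1 - j) (1 - i)) =
    (- 1) ^ nat (j - i) * ((1 - \<alpha> i * \<beta> i) * current_coeff \<alpha> \<beta> k i j)"
proof -
  let ?RS = "{(r :: nat, s :: nat). int r - int s = j - i - int k \<and> int r \<le> j - i - 1}"
  have inj: "inj (\<lambda>a :: int. 1 - a)" by (simp add: inj_def)
  have e: "esym r {1 - j + 1..1 - i - 1} (\<lambda>a. - neg_iota \<alpha> a) =
      (- 1) ^ r * esym r {i + 1..j - 1} (\<lambda>a. - \<alpha> a)" for r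
  proof -
    have "{1 - j + 1..1 - i - 1} = (\<lambda>a. 1 - a) ` {i + 1..j - 1}" by simp
    then show ?thesis
      by (simp only: esym_reindex[OF inj]) (simp add: neg_iota_def flip: esym_minus)
  qed
  have h: "hsym s {1 - j..1 - i} (neg_iota \<beta>) = (- 1) ^ s * hsym s {i..j} \<beta>" for s
  proof -
    have "{1 - j..1 - i} = (\<lambda>a. 1 - a) ` {i..j}" by simp
    then show ?thesis
      by (simp only: hsym_reindex[OF inj]) (simp add: neg_iota_def hsym_minus)
  qed
  have parity: "(- 1 :: complex) ^ k * ((- 1) ^ r * (- 1) ^ s) = (- 1) ^ nat (j - i)"
    if "(r, s) \<in> ?RS" for r s
  proof -
    have "int (k + r + s) = int (nat (j - i)) + 2 * int s"
      using that assms by simp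
    then have "k + r + s = nat (j - i) + 2 * s" by linarith
    then have "(- 1 :: complex) ^ (k + r + s) = (- 1) ^ (nat (j - i) + 2 * s)" by (rule arg_cong)
    then show ?thesis by (simp add: power_add power_mult mult.assoc)
  qed
  have "(- 1) ^ k * (\<Sum>(r, s)\<in>?RS. esym r {1 - j + 1..1 - i - 1} (\<lambda>a. - neg_iota \<alpha> a) *
        hsym s {1 - j..1 - i} (neg_iota \<beta>)) =
      (- 1) ^ nat (j - i) * (\<Sum>(r, s)\<in>?RS. esym r {i + 1..j - 1} (\<lambda>a. - \<alpha> a) * hsym s {i..j} \<beta>)"
    unfolding sum_distrib_left
  proof (intro sum.cong refl, goal_cases)
    case (1 x)
    obtain r s where x: "x = (r, s)" by (cases x)
    have "(- 1) ^ k * ((- 1) ^ r * E * ((- 1) ^ s * H)) = (- 1) ^ nat (j - i) * (E * H)"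
      for E H :: complex
      unfolding parity[OF 1[unfolded x], symmetric] by (simp add: mult_ac)
    then show ?case by (simp only: x prod.case e h)
  qed
  moreover have "neg_iota \<alpha> (1 - i) * neg_iota \<beta> (1 - i) = \<alpha> i * \<beta> i"
    by (simp add: neg_iota_def)
  ultimately show ?thesis
    using assms by (simp add: current_coeff_def mult_ac)
qed

lemma normal_ordered_diag:
  "normal_ordered i i v T =
    (if i > 0 then if i \<in> T then v T else 0 else if i \<in> T then 0 else - v T)"
proof -
  have "{s \<in> T - {i}. s > i} = {s \<in> T. s > i}" "{s \<in> insert i T. s > i} = {s \<in> T. s > i}" by auto
  then show ?thesis
    by (auto simp: normal_ordered_def psi_def psi_star_def wedge_sign_def insert_absorb
        simp flip: mult.assoc power_mult_distrib)
qed

lemma normal_ordered_move: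
  fixes v :: "'a::comm_ring_1 fock"
  assumes T: "maya T" and ij: "i < j"
  shows "normal_ordered i j v T =
    (if i \<in> T \<and> j \<notin> T then (- 1) ^ card (T \<inter> {i<..<j}) * v (insert j (T - {i})) else 0)"
proof -
  have fin: "finite {s \<in> T. s > a}" for a
    using T by (rule maya_finite_greater)
  have "normal_ordered i j v T = psi i (psi_star j v) T"
    using clifford_relations(3)[OF fin, of i j v] ij
    by (auto simp: normal_ordered_def add_eq_0_iff)
  also have "\<dots> = (if i \<in> T \<and> j \<notin> T then
      wedge_sign i T * (wedge_sign j T * v (insert j (T - {i}))) else 0)"
    using ij by (auto simp: psi_def psi_star_def wedge_sign_remove[OF fin])
  also have "\<dots> = (if i \<in> T \<and> j \<notin> T then
      (- 1) ^ card (T \<inter> {i<..<j}) * v (insert j (T - {i})) else 0)"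
  proof (cases "i \<in> T \<and> j \<notin> T")
    case True
    then have "{s \<in> T. s > i} = T \<inter> {i<..<j} \<union> {s \<in> T. s > j}"
      using ij by (auto simp: not_less le_less)
    then have "card {s \<in> T. s > i} = card (T \<inter> {i<..<j}) + card {s \<in> T. s > j}"
      using fin by (simp add: card_Un_disjoint disjoint_iff)
    then have "wedge_sign i T * (wedge_sign j T * x) = (- 1) ^ card (T \<inter> {i<..<j}) * x" for x :: 'a
      by (simp add: wedge_sign_def power_add mult.assoc flip: mult.assoc[of "_ ^ card {s \<in> T. s > j}"]
          power_mult_distrib)
    with True show ?thesis by simp
  qed auto
  finally show ?thesis .
qed

lemma card_dual_set_between:
  assumes "i < j"
  shows "card (dual_set T \<inter> {1 - j<..<1 - i}) + card (T \<inter> {i<..<j}) = nat (j - i - 1)"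
proof -
  have "dual_set T \<inter> {1 - j<..<1 - i} = (\<lambda>s. 1 - s) ` ({i<..<j} - T)"
    by (auto simp: dual_set_def set_eq_iff image_iff intro!: bexI[of _ "1 - _"])
  then have "card (dual_set T \<inter> {1 - j<..<1 - i}) = card ({i<..<j} - T)"
    by (simp add: card_image inj_on_def)
  moreover have "card {i<..<j} = card ({i<..<j} \<inter> T) + card ({i<..<j} - T)"
    by (rule card_Int_Diff) simp
  ultimately show ?thesis
    by (simp add: Int_commute)
qed


section \<open>Duality intertwines the operators\<close>

text \<open>
  The graph of the duality operator on the Fock space, up to the constant \<open>c\<close>. It is confined to
  the sets \<open>maya T\<close> since the signs \<open>wedge_sign\<close> have no meaning elsewhere.
\<close>

definition dual_related ::
    "(int \<Rightarrow> complex) \<Rightarrow> complex \<Rightarrow> series fock \<Rightarrow> series fock \<Rightarrow> bool"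
  where "dual_related w c v v' \<longleftrightarrow>
    (\<forall>T. maya T \<longrightarrow> v' (dual_set T) = twist (c * weight w T) (v T))"

lemma current_term_dual:
  fixes \<alpha> \<beta> :: "int \<Rightarrow> complex"
  defines "w \<equiv> \<lambda>s. 1 - \<alpha> s * \<beta> s"
  assumes w: "\<And>s. w s \<noteq> 0" and rel: "dual_related w c v v'" and T: "maya T"
  shows "mps_const (current_coeff (neg_iota \<alpha>) (neg_iota \<beta>) k (1 - j) (1 - i)) *
      normal_ordered (1 - j) (1 - i) v' (dual_set T) =
    twist ((- 1) ^ (k + 1) * (c * weight w T)) (mps_const (current_coeff \<alpha> \<beta> k i j) * normal_ordered i j v T)"
    (is "mps_const ?A' * ?N' = twist _ (mps_const ?A * ?N)")
proof (cases i j rule: linorder_cases)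
  case greater
  then show ?thesis by (simp add: current_coeff_def twist_def)
next
  case equal
  have "?A' = (- 1) ^ k * ?A"
    by (simp add: equal current_coeff_def neg_iota_def power_minus[of "\<beta> j"])
  moreover have "?N' = - twist (c * weight w T) ?N"
    using rel T by (auto simp: equal normal_ordered_diag dual_related_def dual_set_def twist_def omega_minus)
  ultimately show ?thesis
    by (simp add: twist_def omega_mult omega_const mps_const_mult mps_const_minus mult_ac)
next
  case less
  show ?thesis
  proof (cases "i \<in> T \<and> j \<notin> T")
    case False
    then have "?N = 0" "?N' = 0"
      using less T maya_dual_set[OF T] by (auto simp: normal_ordered_move) (auto simp: dual_set_def)
    then show ?thesis by (simp add: twist_def)
  next
    case True
    define U where "U = insert j (T - {i})"
    define e where "e = card (T \<inter> {i<..<j})"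
    define e' where "e' = card (dual_set T \<inter> {1 - j<..<1 - i})"
    have N: "?N = (- 1) ^ e * v U"
      using less T True by (simp add: normal_ordered_move e_def U_def)
    have "?N' = (- 1) ^ e' * v' (dual_set U)"
      using less T True dual_set_move[of i j T]
      by (simp add: normal_ordered_move maya_dual_set e'_def U_def) (simp add: dual_set_def)
    also have "v' (dual_set U) = twist (c * weight w U) (v U)"
      using rel maya_move[OF T] by (simp add: dual_related_def U_def)
    finally have N': "?N' = (- 1) ^ e' * twist (c * weight w U) (v U)" .
    have ee: "e' + e + 1 = nat (j - i)"
      using card_dual_set_between[OF less, of T] less by (simp add: e_def e'_def)
    have "?A' * (- 1) ^ e' * (c * weight w U) = (- 1) ^ (k + 1) * (c * weight w T) * ?A * (- 1) ^ e"
    proof -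
      have sq: "(- 1) ^ n * ((- 1) ^ n * x) = x" for n and x :: complex
        by (simp flip: mult.assoc power_mult_distrib)
      have A': "w j * ?A' = (- 1) ^ k * ((- 1) ^ (e' + e + 1) * (w i * ?A))"
        using current_coeff_neg_iota[OF less, of k \<alpha> \<beta>] unfolding ee w_def by (metis sq)
      have U: "w i * weight w U = w j * weight w T"
        unfolding U_def using True by (intro weight_move w T) auto
      have "(w i * w j) * (?A' * (- 1) ^ e' * (c * weight w U)) =
          (w j * ?A') * (w i * weight w U) * (- 1) ^ e' * c"
        by (simp add: mult_ac)
      also have "\<dots> = (- 1) ^ e' * ((- 1) ^ e' * ((w i * w j) *
          ((- 1) ^ (k + 1) * (c * weight w T) * ?A * (- 1) ^ e)))"
        unfolding A' U by (simp add: power_add mult_ac)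
      also have "\<dots> = (w i * w j) * ((- 1) ^ (k + 1) * (c * weight w T) * ?A * (- 1) ^ e)"
        by (rule sq)
      finally show ?thesis using w[of i] w[of j] by (simp only: mult_cancel_left mult_eq_0_iff) simp
    qed
    then have "mps_const (?A' * (- 1) ^ e' * (c * weight w U)) * omega (v U) =
        mps_const ((- 1) ^ (k + 1) * (c * weight w T) * ?A * (- 1) ^ e) * omega (v U)"
      by simp
    then show ?thesis
      unfolding N N' twist_def omega_mult omega_const omega_minus_one_power mps_const_mult
        mps_const_minus_one_power
      by (simp only: mult_ac)
  qed
qed

lemma current_dual:
  fixes \<alpha> \<beta> :: "int \<Rightarrow> complex"
  defines "w \<equiv> \<lambda>s. 1 - \<alpha> s * \<beta> s"
  assumes w: "\<And>s. w s \<noteq> 0" and c: "c \<noteq> 0" and rel: "dual_related w c v v'" and T: "maya T"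
  shows "current (neg_iota \<alpha>) (neg_iota \<beta>) k v' (dual_set T) =
    twist ((- 1) ^ (k + 1) * (c * weight w T)) (current \<alpha> \<beta> k v T)"
proof -
  define F where "F = (\<lambda>(i, j). mps_const (current_coeff \<alpha> \<beta> k i j) * normal_ordered i j v T)"
  define F' where "F' = (\<lambda>(i, j). mps_const (current_coeff (neg_iota \<alpha>) (neg_iota \<beta>) k i j) *
    normal_ordered i j v' (dual_set T))"
  define r where "r = (\<lambda>(i :: int, j :: int). (1 - j, 1 - i))"
  have "bij r"
    by (rule o_bij[of r]) (auto simp: r_def fun_eq_iff)
  have nz: "(- 1) ^ (k + 1) * (c * weight w T) \<noteq> 0"
    using c w by (simp add: weight_neq_0)
  have "Sum_any F' = Sum_any (\<lambda>p. F' (r p))"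
    using \<open>bij r\<close> by (intro Sum_any.reindex_cong[of r]) auto
  also have "(\<lambda>p. F' (r p)) = (\<lambda>p. twist ((- 1) ^ (k + 1) * (c * weight w T)) (F p))"
    using current_term_dual[of \<alpha> \<beta> c v v' T k] w rel T
    by (auto simp: F_def F'_def r_def w_def)
  also have "Sum_any \<dots> = twist ((- 1) ^ (k + 1) * (c * weight w T)) (Sum_any F)"
    by (rule Sum_any_hom) (simp_all only: twist_add twist_eq_0_iff[OF nz])
  finally show ?thesis
    by (simp add: current_def F_def F'_def)
qed

text \<open>Here the sign of the currents cancels against the sign of \<open>\<omega> p_k\<close>.\<close>

lemma dual_related_H_plus:
  fixes \<alpha> \<beta> :: "int \<Rightarrow> complex"
  defines "w \<equiv> \<lambda>s. 1 - \<alpha> s * \<beta> s"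
  assumes w: "\<And>s. w s \<noteq> 0" and c: "c \<noteq> 0" and rel: "dual_related w c v v'"
  shows "dual_related w c (H_plus \<alpha> \<beta> v) (H_plus (neg_iota \<alpha>) (neg_iota \<beta>) v')"
  unfolding dual_related_def
proof (intro allI impI)
  fix T assume T: "maya T"
  have nz: "c * weight w T \<noteq> 0"
    using c w by (simp add: weight_neq_0)
  have "mps_const (1 / of_nat (Suc n)) * pvar (Suc n) *
        current (neg_iota \<alpha>) (neg_iota \<beta>) (Suc n) v' (dual_set T) =
      twist (c * weight w T) (mps_const (1 / of_nat (Suc n)) * pvar (Suc n) * current \<alpha> \<beta> (Suc n) v T)"
    for n
    using current_dual[of \<alpha> \<beta> c v v' T "Suc n"] w c rel T
    by (simp add: w_def twist_def omega_mult omega_const omega_pvar mps_const_mult mult_ac)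
  then show "H_plus (neg_iota \<alpha>) (neg_iota \<beta>) v' (dual_set T) = twist (c * weight w T) (H_plus \<alpha> \<beta> v T)"
    by (simp add: H_plus_def twist_mps_sum[OF nz])
qed

lemma dual_related_exp_op:
  assumes w: "\<And>s. w s \<noteq> 0" and c: "c \<noteq> 0"
    and X: "\<And>v v'. dual_related w c v v' \<Longrightarrow> dual_related w c (X v) (X' v')"
    and rel: "dual_related w c v v'"
  shows "dual_related w c (exp_op X v) (exp_op X' v')"
  unfolding dual_related_def
proof (intro allI impI)
  fix T assume T: "maya T"
  have nz: "c * weight w T \<noteq> 0"
    using c w by (simp add: weight_neq_0)
  have "dual_related w c ((X ^^ n) v) ((X' ^^ n) v')" for n
    by (induction n) (simp_all add: rel X)
  then have "mps_const (1 / fact n) * (X' ^^ n) v' (dual_set T) =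
      twist (c * weight w T) (mps_const (1 / fact n) * (X ^^ n) v T)" for n
    using T by (simp add: dual_related_def twist_def omega_mult omega_const mult_ac)
  then show "exp_op X' v' (dual_set T) = twist (c * weight w T) (exp_op X v T)"
    by (simp add: exp_op_def twist_mps_sum[OF nz])
qed

lemma dual_related_ket:
  assumes lam: "is_partition lam" and w: "\<And>s. w s \<noteq> 0"
  shows "dual_related w (1 / weight w (part_set lam)) (ket lam) (ket (conjugate lam))"
proof -
  have "dual_set T = dual_set (part_set lam) \<longleftrightarrow> T = part_set lam" for T
    by (metis dual_set_involution)
  then show ?thesis
    using w by (simp add: dual_related_def ket_def wedge_def part_set_conjugate[OF lam] twist_def weight_neq_0)
qed

theorem corollary5p15:
  fixes \<alpha> \<beta> :: "int \<Rightarrow> complex"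
    and lam mu :: "nat \<Rightarrow> nat"
    and m :: nat
  assumes "\<And>i. 1 - \<alpha> i * \<beta> i \<noteq> 0"
    and "is_partition lam"
    and "is_partition mu"
    and "m \<ge> max (part_length lam) (part_length mu)"
  shows "omega (skew_schur lam mu \<alpha> \<beta>) =
    mps_const (\<Prod>i = 1..m.
        (1 - \<alpha> (int (lam (i - 1)) - int i + 1) * \<beta> (int (lam (i - 1)) - int i + 1)) /
        (1 - \<alpha> (int (mu (i - 1)) - int i + 1) * \<beta> (int (mu (i - 1)) - int i + 1))) *
    skew_schur (conjugate lam) (conjugate mu) (neg_iota \<alpha>) (neg_iota \<beta>)"
proof -
  define w where "w = (\<lambda>s. 1 - \<alpha> s * \<beta> s)"
  have w: "w s \<noteq> 0" for s
    using assms(1) by (simp add: w_def)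
  let ?L = "weight w (part_set lam)" and ?M = "weight w (part_set mu)"
  have nz: "?L \<noteq> 0" "?M \<noteq> 0"
    using w by (simp_all add: weight_neq_0)
  have "dual_related w (1 / ?L) (exp_op (H_plus \<alpha> \<beta>) (ket lam))
      (exp_op (H_plus (neg_iota \<alpha>) (neg_iota \<beta>)) (ket (conjugate lam)))"
  proof (rule dual_related_exp_op)
    show "dual_related w (1 / ?L) (H_plus \<alpha> \<beta> v) (H_plus (neg_iota \<alpha>) (neg_iota \<beta>) v')"
      if "dual_related w (1 / ?L) v v'" for v v'
      using dual_related_H_plus[of \<alpha> \<beta> "1 / ?L" v v'] that assms(1) nz by (simp add: w_def)
  qed (use w nz dual_related_ket[OF assms(2), of w] in auto)
  then have dual: "skew_schur (conjugate lam) (conjugate mu) (neg_iota \<alpha>) (neg_iota \<beta>) =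
      mps_const (?M / ?L) * omega (skew_schur lam mu \<alpha> \<beta>)"
    using maya_part_set[OF assms(3)]
    by (simp add: dual_related_def skew_schur_def bra_def part_set_conjugate[OF assms(3)] twist_def)
  have "(\<Prod>i = 1..m.
        (1 - \<alpha> (int (lam (i - 1)) - int i + 1) * \<beta> (int (lam (i - 1)) - int i + 1)) /
        (1 - \<alpha> (int (mu (i - 1)) - int i + 1) * \<beta> (int (mu (i - 1)) - int i + 1))) =
      (\<Prod>i<m. w (int (lam i) - int i) / w (int (mu i) - int i))"
    by (rule prod.reindex_bij_witness[where i = Suc and j = "\<lambda>i. i - 1"])
      (auto simp: w_def of_nat_diff algebra_simps)
  also have "\<dots> = ?L / ?M"
    using weight_part_set[of w lam m, OF w assms(2)] weight_part_set[of w mu m, OF w assms(3)]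
      assms(4) w
    by (simp add: prod_dividef)
  finally show ?thesis
    using nz unfolding dual by (simp flip: mult.assoc mps_const_mult)
qed

end
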